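(* If the problem $$\text{find } u\in\mathcal H\text{ such that } a(u,v_h)=F(v_h)\quad\forall v_h\in V_h$$ admits at least one solution $u^*\in\mathcal H$, then it admits infinitely many solutions in $\mathcal H$. More precisely, there is $\Phi\in\mathcal H_0\setminus\{0\}$ solving the homogeneous problem $a(\Phi,v_h)=0$ for all $v_h\in V_h$, and $u^*+\lambda\Phi\in\mathcal H$ is a solution for every $\lambda\in\mathbb R$.
   Context: Let $U$ be a (real) Hilbert space and let $V_h\subset U$ be a finite-dimensional subspace (test space) with $\dim(V_h)=n<\infty$. Let $\mathcal A\subset U$ be the admissible trial space and $\mathcal H\subseteq\mathcal A$ the admissible neural trial class. Let $a(\cdot,\cdot):U\times V_h\to\mathbb R$ be a bilinear form and $F:V_h\to\mathbb R$ a linear functional. Let $\mathcal H_0\subset U$ be a homogeneous neural perturbation class, i.e. a set that is closed under finite linear combinations, contains at least $n+1$ linearly independent functions, and preserves admissibility in the sense that $u\in\mathcal H$ and $\Phi\in\mathcal H_0$ imply $u+\Phi\in\mathcal H$. *)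

theory Defs
  imports "HOL-Analysis.Analysis"
begin

text \<open>
  The test space is a subset of the type of the ambient space \<open>U\<close>. Functionals on it, and forms on
  the product of \<open>U\<close> with it, are total functions of which only the values on the test space matter.
\<close>

definition linear_functional_on :: "'u::real_vector set \<Rightarrow> ('u \<Rightarrow> real) \<Rightarrow> bool" where
  "linear_functional_on V f \<longleftrightarrow>
     (\<forall>v\<in>V. \<forall>w\<in>V. f (v + w) = f v + f w) \<and> (\<forall>c. \<forall>v\<in>V. f (c *\<^sub>R v) = c * f v)"

definition bilinear_form_on :: "'u::real_vector set \<Rightarrow> ('u \<Rightarrow> 'u \<Rightarrow> real) \<Rightarrow> bool" where
  "bilinear_form_on V a \<longleftrightarrow>
     (\<forall>v\<in>V. linear (\<lambda>u. a u v)) \<and> (\<forall>u. linear_functional_on V (a u))"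

definition solutions ::
    "('u \<Rightarrow> 'u \<Rightarrow> real) \<Rightarrow> ('u \<Rightarrow> real) \<Rightarrow> 'u set \<Rightarrow> 'u set \<Rightarrow> 'u set" where
  "solutions a F V H = {u \<in> H. \<forall>v\<in>V. a u v = F v}"

text \<open>
  Closure under finite linear combinations is rendered by \<open>subspace\<close>; the zero vector that this
  includes is the empty (or a trivial) linear combination.
\<close>

definition homogeneous_perturbation_class ::
    "nat \<Rightarrow> 'u::real_vector set \<Rightarrow> 'u set \<Rightarrow> bool" where
  "homogeneous_perturbation_class n H H0 \<longleftrightarrow>
     subspace H0 \<and>
     (\<exists>S\<subseteq>H0. finite S \<and> card S = n + 1 \<and> independent S) \<and>
     (\<forall>u\<in>H. \<forall>\<Phi>\<in>H0. u + \<Phi> \<in> H)"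

end

theory Submission
  imports Defs
begin

text \<open>
  Testing against a basis of the test space turns the homogeneous problem into \<open>n\<close> linear
  equations, so among \<open>n + 1\<close> linearly independent perturbations some non-trivial combination
  \<open>\<Phi>\<close> solves it (\<open>more_unknowns_than_equations\<close>). Functionals on a space are determined by
  their values on a spanning set (\<open>linear_functional_on_zero\<close>), so \<open>\<Phi>\<close> solves the
  homogeneous problem for every test vector. Since the perturbation class is closed under scaling
  and preserves admissibility, adding multiples of \<open>\<Phi>\<close> to one solution gives a whole line of
  solutions, and a line with non-zero direction is infinite.
\<close>

lemma linear_functional_on_zero:
  assumes f: "linear_functional_on (span B) f" and B: "\<And>b. b \<in> B \<Longrightarrow> f b = 0"
    and v: "v \<in> span B"
  shows "f v = 0"
proof -
  have "subspace {v \<in> span B. f v = 0}"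
  proof (rule subspaceI)
    have "f (0 *\<^sub>R 0) = 0 * f 0"
      using f span_zero unfolding linear_functional_on_def by blast
    then show "0 \<in> {v \<in> span B. f v = 0}"
      by (simp add: span_zero)
  next
    fix x y assume "x \<in> {v \<in> span B. f v = 0}" "y \<in> {v \<in> span B. f v = 0}"
    then have xy: "x \<in> span B" "y \<in> span B" "f x = 0" "f y = 0"
      by blast+
    then have "f (x + y) = f x + f y"
      using f unfolding linear_functional_on_def by blast
    with xy show "x + y \<in> {v \<in> span B. f v = 0}"
      by (simp add: span_add)
  next
    fix c x assume "x \<in> {v \<in> span B. f v = 0}"
    then have x: "x \<in> span B" "f x = 0"
      by blast+
    then have "f (c *\<^sub>R x) = c * f x"
      using f unfolding linear_functional_on_def by blast
    with x show "c *\<^sub>R x \<in> {v \<in> span B. f v = 0}"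
      by (simp add: span_scale)
  qed
  moreover have "B \<subseteq> {v \<in> span B. f v = 0}"
    using B span_base by blast
  ultimately show ?thesis
    using v span_minimal by blast
qed

text \<open>
  The functionals are assembled into the single map \<open>\<lambda>u. \<Sum>b\<in>B. g b u *\<^sub>R b\<close>, which vanishes
  exactly where all of them do because \<open>B\<close> is independent. Were it injective on the span of \<open>S\<close>,
  it would carry \<open>S\<close> to an independent subset of the span of \<open>B\<close> that is larger than \<open>B\<close>.
\<close>

lemma more_unknowns_than_equations:
  fixes B :: "'b::real_vector set" and S :: "'u::real_vector set"
    and g :: "'b \<Rightarrow> 'u \<Rightarrow> real"
  assumes "finite B" "independent B" and g: "\<And>b. b \<in> B \<Longrightarrow> linear (g b)"
    and S: "independent S" "card B < card S"
  shows "\<exists>x\<in>span S. x \<noteq> 0 \<and> (\<forall>b\<in>B. g b x = 0)"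
proof -
  define T where "T u = (\<Sum>b\<in>B. g b u *\<^sub>R b)" for u
  have T: "linear T"
    unfolding T_def
    by (rule linearI)
       (simp_all add: linear_add[OF g] linear_scale[OF g] scaleR_add_left sum.distrib scaleR_sum_right)
  have "\<not> inj_on T (span S)"
  proof
    assume inj: "inj_on T (span S)"
    have "independent (T ` S)"
      using linear_independent_injective_image[OF T S(1) inj] .
    moreover have "T ` S \<subseteq> span B"
      unfolding T_def by (intro image_subsetI span_sum span_scale span_base)
    ultimately have "card (T ` S) \<le> card B"
      using independent_span_bound[OF \<open>finite B\<close>] by blast
    moreover have "card (T ` S) = card S"
      using card_image[OF inj_on_subset[OF inj span_superset]] .
    ultimately show False using S(2) by simp
  qed
  then obtain x where x: "x \<in> span S" "x \<noteq> 0" "T x = 0"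
    using linear_injective_on_subspace_0[OF T subspace_span] by blast
  have "\<forall>b\<in>B. g b x = 0"
    using x(3) independentD[OF \<open>independent B\<close> \<open>finite B\<close> order_refl, of "\<lambda>b. g b x"]
    unfolding T_def by blast
  with x show ?thesis by blast
qed

lemma infinite_line:
  fixes x d :: "'u::real_vector"
  assumes "d \<noteq> 0"
  shows "infinite (range (\<lambda>t::real. x + t *\<^sub>R d))"
proof -
  have "inj (\<lambda>t::real. x + t *\<^sub>R d)"
    using assms by (auto intro: injI)
  then show ?thesis
    using finite_imageD infinite_UNIV_char_0 by blast
qed

theorem corollary5p2:
  fixes V\<^sub>h A H H0 :: "'u::{real_inner, complete_space} set"
    and a :: "'u \<Rightarrow> 'u \<Rightarrow> real"
    and F :: "'u \<Rightarrow> real"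
    and n :: nat
    and ustar :: 'u
  assumes "subspace V\<^sub>h"
    and "\<exists>B. finite B \<and> span B = V\<^sub>h"
    and "dim V\<^sub>h = n"
    and "H \<subseteq> A"
    and "bilinear_form_on V\<^sub>h a"
    and "linear_functional_on V\<^sub>h F"
    and "homogeneous_perturbation_class n H H0"
    and "ustar \<in> solutions a F V\<^sub>h H"
  shows "infinite (solutions a F V\<^sub>h H) \<and>
         (\<exists>\<Phi>\<in>H0 - {0}. (\<forall>v\<in>V\<^sub>h. a \<Phi> v = 0) \<and>
            (\<forall>t::real. ustar + t *\<^sub>R \<Phi> \<in> solutions a F V\<^sub>h H))"
proof -
  obtain B where B: "B \<subseteq> V\<^sub>h" "independent B" "V\<^sub>h \<subseteq> span B" "card B = n"
    using basis_exists[of V\<^sub>h] assms(3) by blast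
  have span_B: "span B = V\<^sub>h"
    using B span_minimal[OF _ assms(1)] by blast
  \<comment> \<open>An infinite \<open>B\<close> would also have \<open>card B = n\<close> when \<open>n = 0\<close>, so finiteness is
      drawn from the finite spanning set.\<close>
  have "finite B"
    using assms(2) B independent_span_bound by metis
  obtain S where S: "S \<subseteq> H0" "card S = n + 1" "independent S"
    and H0: "subspace H0" and admissible: "\<And>u \<Phi>. u \<in> H \<Longrightarrow> \<Phi> \<in> H0 \<Longrightarrow> u + \<Phi> \<in> H"
    using assms(7) unfolding homogeneous_perturbation_class_def by blast
  have lin: "linear (\<lambda>u. a u v)" if "v \<in> V\<^sub>h" for v
    using assms(5) that unfolding bilinear_form_on_def by blast
  obtain \<Phi> where \<Phi>: "\<Phi> \<in> span S" "\<Phi> \<noteq> 0" "\<forall>b\<in>B. a \<Phi> b = 0"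
    using more_unknowns_than_equations[of B "\<lambda>b u. a u b" S] \<open>finite B\<close> B(1,2,4) S(2,3) lin
    by (metis less_add_one subsetD)
  have "\<Phi> \<in> H0"
    using \<Phi>(1) span_minimal[OF S(1) H0] by blast
  have hom: "a \<Phi> v = 0" if "v \<in> V\<^sub>h" for v
    using linear_functional_on_zero[of B "a \<Phi>" v] assms(5) \<Phi>(3) that
    unfolding bilinear_form_on_def span_B by blast
  have sol: "ustar + t *\<^sub>R \<Phi> \<in> solutions a F V\<^sub>h H" for t :: real
  proof -
    have "ustar + t *\<^sub>R \<Phi> \<in> H"
      using assms(8) admissible subspace_scale[OF H0 \<open>\<Phi> \<in> H0\<close>]
      unfolding solutions_def by blast
    moreover have "a (ustar + t *\<^sub>R \<Phi>) v = F v" if "v \<in> V\<^sub>h" for v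
      using linear_add[OF lin[OF that]] linear_scale[OF lin[OF that]] hom[OF that] assms(8) that
      unfolding solutions_def by simp
    ultimately show ?thesis unfolding solutions_def by blast
  qed
  have "infinite (solutions a F V\<^sub>h H)"
    by (rule infinite_super[OF image_subsetI infinite_line[OF \<Phi>(2)]]) (rule sol)
  with \<Phi>(2) \<open>\<Phi> \<in> H0\<close> hom sol show ?thesis by blast
qed

end
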